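(* In an open shop system, a state $s$ is unsafe if and only if it has a blocking set of machines.
   Context: An open shop system consists of $n$ jobs $J_1,\ldots,J_n$ and $m$ machines $M_1,\ldots,M_m$. Each job $J_j$ has a set $\mathcal{M}(J_j)\subseteq\{M_1,\ldots,M_m\}$ of machines on which it must be processed, in an arbitrary order; each machine $M_i$ has a positive integer capacity $\mathrm{cap}(M_i)$. There are two artificial machines $M_0$ and $M_{m+1}$ of unbounded capacity. A state $s$ specifies for every job $J_j$ a machine $M^s(J_j)\in\{M_0,\ldots,M_{m+1}\}$ on which it currently sits and a set $\mathcal{M}^s(J_j)\subseteq\mathcal{M}(J_j)\setminus\{M^s(J_j)\}$ of machines on which it still needs processing; each machine $M_i$, $1\le i\le m$, holds at most $\mathrm{cap}(M_i)$ jobs. $\mathcal{J}^s(M_i)$ is the set of jobs $J_j$ with $M^s(J_j)=M_i$. The final state $f$ has $M^f(J_j)=M_{m+1}$ and $\mathcal{M}^f(J_j)=\emptyset$ for all $j$. A state $t$ is a successor of $s$ if $t$ arises from $s$ by moving a single job $J_j$ from $M^s(J_j)$ to some machine $M\in\mathcal{M}^s(J_j)$ that currently holds fewer than $\mathrm{cap}(M)$ jobs (then $M^t(J_j)=M$, $\mathcal{M}^t(J_j)=\mathcal{M}^s(J_j)\setminus\{M\}$), or by moving a job $J_j$ with $\mathcal{M}^s(J_j)=\emptyset$ and $M^s(J_j)\ne M_{m+1}$ to $M_{m+1}$. Reachability from $s$ means via a finite sequence of successor steps. A state is safe if $f$ is reachable from it, unsafe otherwise. A machine $M$ is full in $s$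 if $|\mathcal{J}^s(M)|=\mathrm{cap}(M)$. A nonempty set $\mathcal{B}\subseteq\{M_1,\ldots,M_m\}$ is blocking for $s$ if every machine in $\mathcal{B}$ is full and every job $J$ sitting on a machine of $\mathcal{B}$ satisfies $\emptyset\neq\mathcal{M}^s(J)\subseteq\mathcal{B}$. *)

theory Defs
  imports Main "HOL-Library.FuncSet"
begin

text \<open>
  Jobs are the indices \<open>1..n\<close>, proper machines the indices \<open>1..m\<close>; the indices \<open>0\<close> and \<open>m + 1\<close>
  are the two artificial machines of unbounded capacity.
\<close>

record open_shop =
  num_jobs :: nat
  num_machines :: nat
  req :: "nat \<Rightarrow> nat set"
  cap :: "nat \<Rightarrow> nat"

definition jobs :: "open_shop \<Rightarrow> nat set" where
  "jobs S = {1..num_jobs S}"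

definition machines :: "open_shop \<Rightarrow> nat set" where
  "machines S = {1..num_machines S}"

definition exit_machine :: "open_shop \<Rightarrow> nat" where
  "exit_machine S = num_machines S + 1"

definition open_shop_system :: "open_shop \<Rightarrow> bool" where
  "open_shop_system S \<longleftrightarrow>
     (\<forall>j\<in>jobs S. req S j \<subseteq> machines S) \<and> (\<forall>i\<in>machines S. cap S i > 0)"

record state =
  loc :: "nat \<Rightarrow> nat"
  need :: "nat \<Rightarrow> nat set"

definition jobs_on :: "open_shop \<Rightarrow> state \<Rightarrow> nat \<Rightarrow> nat set" where
  "jobs_on S s i = {j \<in> jobs S. loc s j = i}"

text \<open>
  The components of a state are extensional functions on the jobs (\<open>\<rightarrow>\<^sub>E\<close>, \<open>\<Pi>\<^sub>E\<close>), so that states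
  carry no information outside \<open>jobs S\<close> and the final state is unique.
\<close>

definition is_state :: "open_shop \<Rightarrow> state \<Rightarrow> bool" where
  "is_state S s \<longleftrightarrow>
     loc s \<in> jobs S \<rightarrow>\<^sub>E {0..exit_machine S} \<and>
     need s \<in> (\<Pi>\<^sub>E j\<in>jobs S. Pow (req S j - {loc s j})) \<and>
     (\<forall>i\<in>machines S. card (jobs_on S s i) \<le> cap S i)"

definition final_state :: "open_shop \<Rightarrow> state" where
  "final_state S = \<lparr>loc = (\<lambda>j\<in>jobs S. exit_machine S), need = (\<lambda>j\<in>jobs S. {})\<rparr>"

inductive successor :: "open_shop \<Rightarrow> state \<Rightarrow> state \<Rightarrow> bool" for S where
  process:
    "\<lbrakk>j \<in> jobs S; M \<in> need s j; card (jobs_on S s M) < cap S M\<rbrakk> \<Longrightarrow>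
     successor S s \<lparr>loc = (loc s)(j := M), need = (need s)(j := need s j - {M})\<rparr>"
| leave:
    "\<lbrakk>j \<in> jobs S; need s j = {}; loc s j \<noteq> exit_machine S\<rbrakk> \<Longrightarrow>
     successor S s \<lparr>loc = (loc s)(j := exit_machine S), need = need s\<rparr>"

definition reachable :: "open_shop \<Rightarrow> state \<Rightarrow> state \<Rightarrow> bool" where
  "reachable S = (successor S)\<^sup>*\<^sup>*"

definition safe :: "open_shop \<Rightarrow> state \<Rightarrow> bool" where
  "safe S s \<longleftrightarrow> reachable S s (final_state S)"

definition unsafe :: "open_shop \<Rightarrow> state \<Rightarrow> bool" where
  "unsafe S s \<longleftrightarrow> \<not> safe S s"

definition full :: "open_shop \<Rightarrow> state \<Rightarrow> nat \<Rightarrow> bool" where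
  "full S s i \<longleftrightarrow> card (jobs_on S s i) = cap S i"

definition blocking :: "open_shop \<Rightarrow> state \<Rightarrow> nat set \<Rightarrow> bool" where
  "blocking S s B \<longleftrightarrow>
     B \<noteq> {} \<and> B \<subseteq> machines S \<and>
     (\<forall>i\<in>B. full S s i) \<and>
     (\<forall>i\<in>B. \<forall>j\<in>jobs_on S s i. need s j \<noteq> {} \<and> need s j \<subseteq> B)"

lemma is_state_final_state: "open_shop_system S \<Longrightarrow> is_state S (final_state S)"
  by (auto simp: is_state_def final_state_def jobs_on_def machines_def exit_machine_def
      cong: conj_cong)

lemma is_state_successor:
  assumes "open_shop_system S" "is_state S s" "successor S s t"
  shows "is_state S t"
  using assms(3)
proof cases
  case (process j M)
  have fin: "finite (jobs_on S s i)" for i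
    by (simp add: jobs_on_def jobs_def)
  have M: "M \<in> req S j" "M \<in> machines S"
    using assms(1,2) process by (fastforce simp: is_state_def open_shop_system_def PiE_iff)+
  have "card (jobs_on S t i) \<le> cap S i" if "i \<in> machines S" for i
  proof (cases "i = M")
    case True
    have "jobs_on S t M \<subseteq> insert j (jobs_on S s M)"
      by (auto simp: process jobs_on_def)
    then have "card (jobs_on S t M) \<le> card (insert j (jobs_on S s M))"
      by (intro card_mono) (use fin in auto)
    also have "\<dots> \<le> Suc (card (jobs_on S s M))"
      by (simp add: card_insert_if fin)
    finally show ?thesis
      using process True by simp
  next
    case False
    then have "jobs_on S t i \<subseteq> jobs_on S s i"
      by (auto simp: process jobs_on_def)
    then have "card (jobs_on S t i) \<le> card (jobs_on S s i)"
      by (intro card_mono) (use fin in auto)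
    then show ?thesis
      using assms(2) that by (fastforce simp: is_state_def)
  qed
  then show ?thesis
    using assms(2) process M
    by (auto simp: is_state_def PiE_iff extensional_def machines_def exit_machine_def)
next
  case (leave j)
  have "card (jobs_on S t i) \<le> cap S i" if "i \<in> machines S" for i
  proof -
    have "jobs_on S t i \<subseteq> jobs_on S s i"
      using that by (auto simp: leave jobs_on_def machines_def exit_machine_def split: if_splits)
    then have "card (jobs_on S t i) \<le> card (jobs_on S s i)"
      by (intro card_mono) (auto simp: jobs_on_def jobs_def)
    then show ?thesis
      using assms(2) that by (fastforce simp: is_state_def)
  qed
  then show ?thesis
    using assms(2) leave by (auto simp: is_state_def PiE_iff extensional_def)
qed

end

theory Submission
  imports Defs
begin

text \<open>
  A blocking set persists under every step, because nobody can enter or leave it, and the final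
  state has none; so a state with a blocking set is unsafe. Conversely, every nonfinal state \<open>s\<close>
  without blocking sets has a successor without blocking sets, and no infinite run exists.
  If a finished job waits to leave, let it leave. Otherwise some move is possible, since otherwise
  the full machines would form a blocking set. Suppose that moving a job to \<open>M\<close> creates
  a blocking set \<open>B\<close>. Then \<open>M \<in> B\<close>, and as \<open>B - {M}\<close> does not block \<open>s\<close>, some job on a machine
  \<open>A \<in> B - {M}\<close> could move to \<open>M\<close> instead. If that move creates a blocking set \<open>B'\<close>, then
  \<open>A \<notin> B'\<close> and \<open>B \<inter> B'\<close> is a smaller blocking set created by it; so the exchange terminates.
\<close>

definition move :: "state \<Rightarrow> nat \<Rightarrow> nat \<Rightarrow> state" where
  "move s j M = \<lparr>loc = (loc s)(j := M), need = (need s)(j := need s j - {M})\<rparr>"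

definition enabled :: "open_shop \<Rightarrow> state \<Rightarrow> nat \<Rightarrow> nat \<Rightarrow> bool" where
  "enabled S s j M \<longleftrightarrow> j \<in> jobs S \<and> M \<in> need s j \<and> card (jobs_on S s M) < cap S M"

lemma loc_move [simp]: "loc (move s j M) = (loc s)(j := M)"
  and need_move [simp]: "need (move s j M) = (need s)(j := need s j - {M})"
  by (simp_all add: move_def)

lemma successor_move: "enabled S s j M \<Longrightarrow> successor S s (move s j M)"
  unfolding enabled_def move_def by (blast intro: successor.process)

lemma finite_jobs [simp]: "finite (jobs S)"
  by (simp add: jobs_def)

lemma finite_jobs_on [simp]: "finite (jobs_on S s i)"
  by (simp add: jobs_on_def)

lemma need_subset_machines:
  assumes "open_shop_system S" "is_state S s" "j \<in> jobs S"
  shows "need s j \<subseteq> machines S"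
  using assms unfolding open_shop_system_def is_state_def PiE_iff by blast

lemma loc_notin_need:
  assumes "is_state S s" "j \<in> jobs S"
  shows "loc s j \<notin> need s j"
  using assms unfolding is_state_def PiE_iff by blast

lemma finite_need:
  assumes "open_shop_system S" "is_state S s" "j \<in> jobs S"
  shows "finite (need s j)"
  using need_subset_machines[OF assms] by (rule finite_subset) (simp add: machines_def)

section \<open>Blocking sets persist under steps\<close>

lemma blockingI:
  assumes "B \<noteq> {}" "B \<subseteq> machines S" "\<And>i. i \<in> B \<Longrightarrow> full S s i"
    and "\<And>j. \<lbrakk>j \<in> jobs S; loc s j \<in> B\<rbrakk> \<Longrightarrow> need s j \<noteq> {} \<and> need s j \<subseteq> B"
  shows "blocking S s B"
  using assms unfolding blocking_def jobs_on_def by blast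

lemma blockingD:
  assumes "blocking S s B"
  shows "B \<noteq> {}" "B \<subseteq> machines S" "i \<in> B \<Longrightarrow> card (jobs_on S s i) = cap S i"
    and "\<lbrakk>j \<in> jobs S; loc s j \<in> B\<rbrakk> \<Longrightarrow> need s j \<noteq> {} \<and> need s j \<subseteq> B"
  using assms unfolding blocking_def jobs_on_def full_def by blast+

text \<open>Serves in both directions: to carry a blocking set along a step and to pull one back to
  the state before it.\<close>

lemma blocking_cong:
  assumes "blocking S s B"
    and "\<And>i. i \<in> B \<Longrightarrow> jobs_on S t i = jobs_on S s i"
    and "\<And>i j. \<lbrakk>i \<in> B; j \<in> jobs_on S s i\<rbrakk> \<Longrightarrow> need t j = need s j"
  shows "blocking S t B"
  using assms unfolding blocking_def full_def by simp

lemma blocking_successor: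
  assumes "blocking S s B" "successor S s t"
  shows "blocking S t B"
  using assms(2)
proof cases
  case (process j M)
  have "M \<notin> B"
    using process blockingD(3)[OF assms(1)] by force
  \<comment> \<open>A job on \<open>B\<close> needs only machines of \<open>B\<close>, hence not
    \<open>M\<close>.\<close>
  moreover have "loc s j \<notin> B"
    using process blockingD(4)[OF assms(1), of j] \<open>M \<notin> B\<close> by blast
  ultimately show ?thesis
    by (intro blocking_cong[OF assms(1)]) (auto simp: process jobs_on_def)
next
  case (leave j)
  have "loc s j \<notin> B"
    using leave blockingD(4)[OF assms(1)] by blast
  moreover have "exit_machine S \<notin> B"
    using blockingD(2)[OF assms(1)] by (auto simp: machines_def exit_machine_def)
  ultimately show ?thesis
    by (intro blocking_cong[OF assms(1)]) (auto simp: leave jobs_on_def)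
qed

text \<open>All jobs are on the exit machine, whereas a full proper machine holds a job because
  capacities are positive.\<close>

lemma not_blocking_final_state:
  assumes "open_shop_system S"
  shows "\<not> blocking S (final_state S) B"
proof
  assume *: "blocking S (final_state S) B"
  then obtain i where i: "i \<in> B" "i \<in> machines S"
    using blockingD(1,2) by blast
  then have "jobs_on S (final_state S) i = {}"
    by (auto simp: jobs_on_def final_state_def machines_def exit_machine_def)
  then show False
    using assms i blockingD(3)[OF * i(1)] by (auto simp: open_shop_system_def)
qed

lemma unsafe_if_blocking:
  assumes "open_shop_system S" "blocking S s B"
  shows "unsafe S s"
proof -
  have "blocking S t B" if "(successor S)\<^sup>*\<^sup>* s t" for t
    using that by induction (auto intro: assms(2) blocking_successor)
  then show ?thesis
    using not_blocking_final_state[OF assms(1)] by (auto simp: unsafe_def safe_def reachable_def)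
qed

section \<open>Exchange argument for moves that create a blocking set\<close>

text \<open>A proper machine that loses \<open>j\<close> drops strictly below its capacity, so it is
  not full in \<open>t\<close>.\<close>

lemma blocking_vacated:
  assumes "is_state S s" "blocking S t B" "j \<in> jobs S"
    and "jobs_on S t (loc s j) = jobs_on S s (loc s j) - {j}"
  shows "loc s j \<notin> B"
proof
  assume B: "loc s j \<in> B"
  have "j \<in> jobs_on S s (loc s j)"
    using assms(3) by (simp add: jobs_on_def)
  then have "card (jobs_on S t (loc s j)) < card (jobs_on S s (loc s j))"
    unfolding assms(4) by (intro card_Diff1_less) auto
  moreover have "card (jobs_on S s (loc s j)) \<le> cap S (loc s j)"
    using assms(1) B blockingD(2)[OF assms(2)] by (auto simp: is_state_def)
  ultimately show False
    using blockingD(3)[OF assms(2) B] by simp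
qed

lemma blocking_move_source:
  assumes "is_state S s" "enabled S s j M" "blocking S (move s j M) B"
  shows "loc s j \<notin> B"
  \<comment> \<open>No job needs the machine it sits on, so \<open>M\<close> differs from the
    source, which really loses \<open>j\<close>.\<close>
  using assms loc_notin_need[OF assms(1), of j]
  by (intro blocking_vacated[OF assms(1,3)]) (auto simp: enabled_def jobs_on_def)

text \<open>Otherwise \<open>B\<close> contains neither source nor target, so the move changes
  nothing on \<open>B\<close>, which would already block \<open>s\<close>.\<close>

lemma blocking_move_target:
  assumes "is_state S s" "\<nexists>B. blocking S s B" "enabled S s j M" "blocking S (move s j M) B"
  shows "M \<in> B"
proof (rule ccontr)
  assume "M \<notin> B"
  then have "blocking S s B"
    using blocking_move_source[OF assms(1,3,4)]
    by (intro blocking_cong[OF assms(4)]) (auto simp: jobs_on_def split: if_splits)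
  with assms(2) show False by blast
qed

lemma enabled_move_without_blocking:
  assumes "is_state S s" "\<nexists>B. blocking S s B" "enabled S s j M"
  shows "\<exists>j M. enabled S s j M \<and> (\<nexists>B. blocking S (move s j M) B)"
proof -
  have "\<exists>j M. enabled S s j M \<and> (\<nexists>B. blocking S (move s j M) B)"
    if "enabled S s j M" "blocking S (move s j M) B" for j M B
    using that
  proof (induction "card B" arbitrary: j M B rule: less_induct)
    case less
    note en = \<open>enabled S s j M\<close> and bl = \<open>blocking S (move s j M) B\<close>
    note D = blockingD[OF bl]
    have M: "M \<in> B"
      using blocking_move_target[OF assms(1,2) en bl] .
    have A: "loc s j \<notin> B"
      using blocking_move_source[OF assms(1) en bl] .
    have needB: "need s k \<noteq> {} \<and> need s k \<subseteq> B" if "k \<in> jobs S" "loc s k \<in> B" for k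
      using D(4)[of k] that A by (cases "k = j") auto
    \<comment> \<open>After the move \<open>j\<close> sits on \<open>M\<close>, and what it still
      needs is nonempty, lies in \<open>B\<close> and avoids \<open>M\<close>.\<close>
    have "B - {M} \<noteq> {}"
      using D(4)[of j] en M by (auto simp: enabled_def)
    moreover have "full S s i" if "i \<in> B - {M}" for i
    proof -
      have "jobs_on S (move s j M) i = jobs_on S s i"
        using that A by (auto simp: jobs_on_def split: if_splits)
      then show ?thesis
        using D(3)[of i] that by (simp add: full_def)
    qed
    moreover have "\<not> blocking S s (B - {M})"
      using assms(2) by blast
    \<comment> \<open>Only closure of the needs can fail for \<open>B - {M}\<close>; as they stay
      inside \<open>B\<close>, the machine missing is \<open>M\<close>.\<close>
    ultimately obtain k where k: "k \<in> jobs S" "loc s k \<in> B" "M \<in> need s k"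
      using blockingI[of "B - {M}" S s] D(2) needB by blast
    have en': "enabled S s k M"
      using en k by (simp add: enabled_def)
    show ?case
    proof (cases "\<exists>B'. blocking S (move s k M) B'")
      case True
      then obtain B' where bl': "blocking S (move s k M) B'"
        by blast
      note D' = blockingD[OF bl']
      have M': "M \<in> B'"
        using blocking_move_target[OF assms(1,2) en' bl'] .
      have A': "loc s k \<notin> B'"
        using blocking_move_source[OF assms(1) en' bl'] .
      \<comment> \<open>\<open>needB\<close> keeps the needs in \<open>B\<close>, also for
        \<open>k\<close>, which comes from \<open>B\<close>; \<open>D'\<close> makes them nonempty
        and keeps them in \<open>B'\<close>.\<close>
      have "blocking S (move s k M) (B \<inter> B')"
      proof (rule blockingI)
        show "full S (move s k M) i" if "i \<in> B \<inter> B'" for i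
          using D'(3) that by (simp add: full_def)
        fix l assume l: "l \<in> jobs S" "loc (move s k M) l \<in> B \<inter> B'"
        then have "loc s l \<in> B"
          using k by (auto split: if_splits)
        then show "need (move s k M) l \<noteq> {} \<and> need (move s k M) l \<subseteq> B \<inter> B'"
          using needB[OF l(1)] D'(4)[OF l(1)] l(2) by (auto split: if_splits)
      qed (use M M' D(2) in auto)
      moreover have "card (B \<inter> B') < card B"
        using A' k D(2) by (intro psubset_card_mono) (auto intro: finite_subset simp: machines_def)
      ultimately show ?thesis
        using less.hyps en' by blast
    qed (use en' in blast)
  qed
  then show ?thesis
    using assms(3) by blast
qed

section \<open>Progress without creating a blocking set\<close>

lemma final_stateI:
  assumes "is_state S s" "\<And>j. j \<in> jobs S \<Longrightarrow> need s j = {} \<and> loc s j = exit_machine S"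
  shows "s = final_state S"
proof -
  have "loc s = (\<lambda>j\<in>jobs S. exit_machine S)" "need s = (\<lambda>j\<in>jobs S. {})"
    using assms by (auto simp: is_state_def PiE_iff extensional_def fun_eq_iff)
  then show ?thesis
    by (simp add: final_state_def)
qed

lemma enabled_move_exists:
  assumes "open_shop_system S" "is_state S s" "s \<noteq> final_state S" "\<nexists>B. blocking S s B"
    and busy: "\<And>j. \<lbrakk>j \<in> jobs S; need s j = {}\<rbrakk> \<Longrightarrow> loc s j = exit_machine S"
  shows "\<exists>j M. enabled S s j M"
proof (rule ccontr)
  assume none: "\<nexists>j M. enabled S s j M"
  define B where "B = {i \<in> machines S. full S s i}"
  have needB: "need s j \<subseteq> B" if "j \<in> jobs S" for j
  proof
    fix i assume i: "i \<in> need s j"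
    then have "i \<in> machines S"
      using need_subset_machines[OF assms(1,2) that] by blast
    moreover have "card (jobs_on S s i) \<le> cap S i"
      using \<open>i \<in> machines S\<close> assms(2) by (simp add: is_state_def)
    ultimately show "i \<in> B"
      using none that i by (force simp: enabled_def B_def full_def)
  qed
  have "blocking S s B"
  proof (rule blockingI)
    obtain j where "j \<in> jobs S" "need s j \<noteq> {}"
      using final_stateI[OF assms(2)] assms(3) busy by blast
    then show "B \<noteq> {}"
      using needB by blast
    \<comment> \<open>By \<open>busy\<close>, a job without needs sits on the exit machine, which is
      outside \<open>B\<close>.\<close>
    show "need s j \<noteq> {} \<and> need s j \<subseteq> B" if "j \<in> jobs S" "loc s j \<in> B" for j
      using that needB busy[of j] by (auto simp: B_def machines_def exit_machine_def)
  qed (auto simp: B_def)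
  with assms(4) show False by blast
qed

lemma successor_without_blocking:
  assumes "open_shop_system S" "is_state S s" "s \<noteq> final_state S" "\<nexists>B. blocking S s B"
  shows "\<exists>t. successor S s t \<and> (\<nexists>B. blocking S t B)"
proof (cases "\<exists>j\<in>jobs S. need s j = {} \<and> loc s j \<noteq> exit_machine S")
  case True
  then obtain j where j: "j \<in> jobs S" "need s j = {}" "loc s j \<noteq> exit_machine S"
    by blast
  define t where "t = \<lparr>loc = (loc s)(j := exit_machine S), need = need s\<rparr>"
  have "\<not> blocking S t B" for B
  proof
    assume bl: "blocking S t B"
    have "loc s j \<notin> B"
      using j by (intro blocking_vacated[OF assms(2) bl]) (auto simp: t_def jobs_on_def)
    moreover have "exit_machine S \<notin> B"
      using blockingD(2)[OF bl] by (auto simp: machines_def exit_machine_def)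
    \<comment> \<open>The departure of \<open>j\<close> touches no machine of
      \<open>B\<close>.\<close>
    ultimately have "blocking S s B"
      by (intro blocking_cong[OF bl]) (auto simp: t_def jobs_on_def split: if_splits)
    with assms(4) show False by blast
  qed
  moreover have "successor S s t"
    unfolding t_def using j by (rule successor.leave)
  ultimately show ?thesis by blast
next
  case False
  then obtain j M where "enabled S s j M"
    using enabled_move_exists[OF assms] by blast
  then show ?thesis
    using enabled_move_without_blocking[OF assms(2,4)] successor_move by blast
qed

section \<open>Termination and the equivalence\<close>

text \<open>
  A job may sit on the exit machine while it still needs processing, so a processing step can
  increase the number of jobs that are not there; hence the factor 2.
\<close>

definition remaining_work :: "open_shop \<Rightarrow> state \<Rightarrow> nat" where
  "remaining_work S s =
     (\<Sum>j\<in>jobs S. 2 * card (need s j) + (if loc s j = exit_machine S then 0 else 1))"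

text \<open>Only the summand of the moved job changes: processing saves 2 and costs at most 1,
  leaving saves 1.\<close>

lemma remaining_work_successor:
  assumes "open_shop_system S" "is_state S s" "successor S s t"
  shows "remaining_work S t < remaining_work S s"
  using assms(3)
proof cases
  case (process j M)
  have "card (need s j) > 0" "card (need s j - {M}) = card (need s j) - 1"
    using process finite_need[OF assms(1,2), of j] by (auto simp: card_gt_0_iff)
  then show ?thesis
    unfolding remaining_work_def using process
    by (intro sum_strict_mono_ex1) auto
next
  case (leave j)
  then show ?thesis
    unfolding remaining_work_def by (intro sum_strict_mono_ex1) auto
qed

lemma safe_if_no_blocking:
  assumes "open_shop_system S" "is_state S s" "\<nexists>B. blocking S s B"
  shows "safe S s"
  using assms(2,3)
proof (induction "remaining_work S s" arbitrary: s rule: less_induct)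
  case less
  show ?case
  proof (cases "s = final_state S")
    case False
    then obtain t where t: "successor S s t" "\<nexists>B. blocking S t B"
      using successor_without_blocking[OF assms(1) less.prems(1) False less.prems(2)] by blast
    then have "safe S t"
      using less.hyps remaining_work_successor is_state_successor assms(1) less.prems(1) by blast
    with t(1) show ?thesis
      by (auto simp: safe_def reachable_def intro: converse_rtranclp_into_rtranclp)
  qed (simp add: safe_def reachable_def)
qed

theorem theorem3p2:
  fixes S :: open_shop and s :: state
  assumes "open_shop_system S" and "is_state S s"
  shows "unsafe S s \<longleftrightarrow> (\<exists>B. blocking S s B)"
  using assms unsafe_if_blocking safe_if_no_blocking unfolding unsafe_def by blast

end
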